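(* Let $\mathcal{H}$ be a real Hilbert space, let $r\geq1$, and let $A_i:\mathcal{H}\rightrightarrows\mathcal{H}$ be maximally monotone operators for $i=1,\ldots,r$. Let $\gamma>0$ and let $(\lambda_n)_{n=0}^\infty$ be a sequence in $[0,1]$ with $\sum_{n\geq0}\lambda_n(1-\lambda_n)=+\infty$. Let $\beta\in{]0,1[}$ and suppose $q\in\operatorname{ran}\left(\operatorname{Id}+\frac{\gamma}{r(1-\beta)}\sum_{i=1}^rA_i\right)$. Given $x_{1,0},\ldots,x_{r,0}\in\mathcal{H}$, define for $n=0,1,2,\ldots$ \[ p_n=\frac{1}{r}\sum_{i=1}^r x_{i,n},\qquad x_{i,n+1}=(1-\lambda_n)x_{i,n}+\lambda_n\left(2\beta J_{(\gamma(A_i)_{-q})}-\operatorname{Id}\right)\left(2 p_n-x_{i,n}\right),\quad i=1,\ldots,r. \] Then: (i) $(x_{i,n+1}-x_{i,n})_{n=0}^\infty$ converges strongly to $0$ for all $i$; (ii) for each $i$, $(x_{i,n})_{n=0}^\infty$ converges weakly to some $x_i^\star\in\mathcal{H}$, and $q+\frac{1}{\beta r}\sum_{i=1}^r x_i^\star=J_{\frac{\gamma}{r(1-\beta)}\sum_{i=1}^rA_i}(q)$; (iii) $\left(q+\frac{1}{\beta}p_n\right)_{n=0}^\infty$ converges strongly to $J_{\frac{\gamma}{r(1-\beta)}\sum_{i=1}^rA_i}(q)$.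
   Context: For an operator $T:\mathcal{H}\rightrightarrows\mathcal{H}$, the resolvent is $J_T:=(\operatorname{Id}+T)^{-1}$; for maximally monotone $T$ it is single-valued with full domain. For $w\in\mathcal{H}$, the inner $w$-perturbation is $T_w(x):=T(x-w)$; thus $\gamma(A_i)_{-q}$ denotes $x\mapsto\gamma A_i(x+q)$. $\operatorname{ran}$ denotes the range. *)

theory Defs
  imports "HOL-Analysis.Analysis"
begin

text \<open>Set-valued operators on a real Hilbert space are modelled as functions
  'a \<Rightarrow> 'a set (the value at x is T x; the graph is {(x,u). u \<in> T x}).
  A real Hilbert space is a type of class real_inner and complete_space.\<close>

definition monotone_op :: "('a::real_inner \<Rightarrow> 'a set) \<Rightarrow> bool" where
  "monotone_op T \<longleftrightarrow> (\<forall>x y u v. u \<in> T x \<longrightarrow> v \<in> T y \<longrightarrow> 0 \<le> (x - y) \<bullet> (u - v))"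

definition maximal_monotone :: "('a::real_inner \<Rightarrow> 'a set) \<Rightarrow> bool" where
  "maximal_monotone T \<longleftrightarrow> monotone_op T \<and>
     (\<forall>S. monotone_op S \<and> (\<forall>x. T x \<subseteq> S x) \<longrightarrow> S = T)"

definition resolvent :: "('a::real_vector \<Rightarrow> 'a set) \<Rightarrow> 'a \<Rightarrow> 'a" where
  "resolvent T x = (THE p. x - p \<in> T p)"

definition ran_id_plus :: "('a::real_vector \<Rightarrow> 'a set) \<Rightarrow> 'a set" where
  "ran_id_plus T = {y. \<exists>x. y - x \<in> T x}"

definition scale_op :: "real \<Rightarrow> ('a::real_vector \<Rightarrow> 'a set) \<Rightarrow> 'a \<Rightarrow> 'a set" where
  "scale_op c T x = (\<lambda>u. c *\<^sub>R u) ` T x"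

definition perturb_op :: "'a::real_vector \<Rightarrow> ('a \<Rightarrow> 'a set) \<Rightarrow> 'a \<Rightarrow> 'a set" where
  "perturb_op w T x = T (x - w)"

definition sum_op :: "('i \<Rightarrow> 'a::real_vector \<Rightarrow> 'a set) \<Rightarrow> 'i set \<Rightarrow> 'a \<Rightarrow> 'a set" where
  "sum_op A I x = {\<Sum>i\<in>I. u i | u. \<forall>i\<in>I. u i \<in> A i x}"

definition weakly_converges_to :: "(nat \<Rightarrow> 'a::real_inner) \<Rightarrow> 'a \<Rightarrow> bool" where
  "weakly_converges_to s l \<longleftrightarrow> (\<forall>y. (\<lambda>n. s n \<bullet> y) \<longlonglongrightarrow> l \<bullet> y)"

end

theory Submission
  imports Defs
begin

text \<open>
  The iteration is a Krasnoselskii--Mann iteration in the product space for the operator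
  \<open>T u = (2\<beta>J\<^sub>i - Id)(2 mean u - u\<^sub>i)\<close>. Reflection in the diagonal is an isometry and the
  \<open>J\<^sub>i\<close> are firmly nonexpansive, so
  \<open>\<parallel>T u - T v\<parallel>\<^sup>2 \<le> \<parallel>u - v\<parallel>\<^sup>2 - 4\<beta>(1 - \<beta>) \<Sum>\<^sub>i \<parallel>J\<^sub>i(\<dots>) - J\<^sub>i(\<dots>)\<parallel>\<^sup>2\<close>.
  The assumption on \<open>q\<close> provides a fixed point, and at every fixed point the \<open>J\<^sub>i(\<dots>)\<close> share one
  value \<open>d\<close>, with mean \<open>\<beta>d\<close> and with \<open>q + d\<close> the resolvent of the scaled sum at \<open>q\<close>. The
  surplus term turns \<open>\<parallel>z\<^sub>n - T z\<^sub>n\<parallel> \<longrightarrow> 0\<close> into strong convergence of \<open>J\<^sub>i(\<dots>)\<close> to \<open>d\<close>.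

  Weak convergence is obtained from asymptotic centers instead of weak compactness: the asymptotic
  center of the iterates along any subfilter is a fixed point of \<open>T\<close>.
\<close>

section \<open>Quadratic estimates for near-optimal sequences and convex combinations\<close>

lemma Cauchy_if_power2_bound:
  fixes a :: "nat \<Rightarrow> 'a::real_normed_vector"
  assumes "\<And>m n. (norm (a m - a n))\<^sup>2 \<le> C * (1 / real (Suc m) + 1 / real (Suc n))"
  shows "Cauchy a"
proof (rule metric_CauchyI)
  fix e :: real
  assume e: "e > 0"
  have "(\<lambda>n. \<bar>C\<bar> * (1 / real (Suc n))) \<longlonglongrightarrow> \<bar>C\<bar> * 0"
    using LIMSEQ_inverse_real_of_nat by (intro tendsto_mult tendsto_const) (simp add: inverse_eq_divide)
  then have "\<forall>\<^sub>F n in sequentially. \<bar>C\<bar> * (1 / real (Suc n)) < e\<^sup>2 / 2"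
    by (rule order_tendstoD) (use e in simp)
  then obtain N where N: "\<And>n. n \<ge> N \<Longrightarrow> \<bar>C\<bar> * (1 / real (Suc n)) < e\<^sup>2 / 2"
    unfolding eventually_sequentially by blast
  have "dist (a m) (a n) < e" if "m \<ge> N" "n \<ge> N" for m n
  proof -
    have "(norm (a m - a n))\<^sup>2 \<le> C * (1 / real (Suc m) + 1 / real (Suc n))"
      by (rule assms)
    also have "\<dots> \<le> \<bar>C\<bar> * (1 / real (Suc m) + 1 / real (Suc n))"
      by (intro mult_right_mono) auto
    also have "\<dots> < e\<^sup>2"
      using N[OF that(1)] N[OF that(2)] by (simp only: distrib_left)
    finally have "(norm (a m - a n))\<^sup>2 < e\<^sup>2" .
    then show ?thesis
      using e by (simp add: dist_norm power_less_imp_less_base)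
  qed
  then show "\<exists>M. \<forall>m\<ge>M. \<forall>n\<ge>M. dist (a m) (a n) < e" by blast
qed

text \<open>The negative last term is the strong convexity of the squared norm. It drives the dual
  argument for Minty's theorem, the uniqueness of asymptotic centers and the Krasnoselskii-Mann
  estimate.\<close>

lemma norm_convex_combination_power2:
  fixes u v :: "'a::real_inner"
  shows "(norm ((1 - t) *\<^sub>R u + t *\<^sub>R v))\<^sup>2
    = (1 - t) * (norm u)\<^sup>2 + t * (norm v)\<^sup>2 - t * (1 - t) * (norm (u - v))\<^sup>2"
  by (simp add: power2_norm_eq_inner inner_simps inner_commute algebra_simps)

section \<open>Minty's theorem\<close>

text \<open>Adjoining one pair that is monotonically related to the whole graph keeps the graph
  monotone, so maximality can be tested pair by pair.\<close>

lemma maximal_monotone_iff: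
  "maximal_monotone T \<longleftrightarrow> monotone_op T \<and>
     (\<forall>x u. (\<forall>y v. v \<in> T y \<longrightarrow> 0 \<le> (x - y) \<bullet> (u - v)) \<longrightarrow> u \<in> T x)"
proof (intro iffI conjI allI impI)
  assume T: "maximal_monotone T"
  then show mono: "monotone_op T" by (simp add: maximal_monotone_def)
  fix x u assume rel: "\<forall>y v. v \<in> T y \<longrightarrow> 0 \<le> (x - y) \<bullet> (u - v)"
  define S where "S = T(x := insert u (T x))"
  have sym: "(y - x) \<bullet> (v - u) = (x - y) \<bullet> (u - v)" for y v
    by (simp add: inner_simps)
  have "monotone_op S"
    using mono rel unfolding monotone_op_def S_def
    by (auto simp: sym split: if_splits)
  moreover have "\<forall>y. T y \<subseteq> S y" by (auto simp: S_def)
  ultimately have "S = T" using T unfolding maximal_monotone_def by blast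
  then show "u \<in> T x" by (metis S_def fun_upd_same insertI1)
next
  assume T: "monotone_op T \<and> (\<forall>x u. (\<forall>y v. v \<in> T y \<longrightarrow> 0 \<le> (x - y) \<bullet> (u - v)) \<longrightarrow> u \<in> T x)"
  have "S = T" if "monotone_op S" "\<forall>x. T x \<subseteq> S x" for S
  proof (rule ext, rule subset_antisym)
    fix x show "S x \<subseteq> T x"
      using T that unfolding monotone_op_def by blast
  qed (use that in blast)
  then show "maximal_monotone T" using T unfolding maximal_monotone_def by blast
qed

lemma monotone_op_scale:
  assumes "monotone_op T" "c > 0"
  shows "monotone_op (scale_op c T)"
  using assms unfolding monotone_op_def scale_op_def
  by (auto simp flip: scaleR_diff_right)

lemma maximal_monotone_scale:
  assumes T: "maximal_monotone T" and c: "c > 0"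
  shows "maximal_monotone (scale_op c T)"
  unfolding maximal_monotone_iff
proof (intro conjI allI impI)
  show "monotone_op (scale_op c T)"
    using T c by (intro monotone_op_scale) (auto simp: maximal_monotone_def)
  fix x u assume rel: "\<forall>y v. v \<in> scale_op c T y \<longrightarrow> 0 \<le> (x - y) \<bullet> (u - v)"
  have "0 \<le> (x - y) \<bullet> ((1 / c) *\<^sub>R u - v)" if "v \<in> T y" for y v
  proof -
    have "0 \<le> (x - y) \<bullet> (u - c *\<^sub>R v)"
      using rel that by (auto simp: scale_op_def)
    also have "u - c *\<^sub>R v = c *\<^sub>R ((1 / c) *\<^sub>R u - v)"
      using c by (simp add: scaleR_diff_right)
    finally show ?thesis using c by (simp add: zero_le_mult_iff)
  qed
  then have "(1 / c) *\<^sub>R u \<in> T x"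
    using T unfolding maximal_monotone_iff by blast
  then have "c *\<^sub>R ((1 / c) *\<^sub>R u) \<in> scale_op c T x"
    unfolding scale_op_def by (rule imageI)
  then show "u \<in> scale_op c T x" using c by simp
qed

lemma maximal_monotone_perturb:
  assumes T: "maximal_monotone T"
  shows "maximal_monotone (perturb_op w T)"
  unfolding maximal_monotone_iff
proof (intro conjI allI impI)
  have mono: "\<And>x y u v. u \<in> T x \<Longrightarrow> v \<in> T y \<Longrightarrow> 0 \<le> (x - y) \<bullet> (u - v)"
    using T unfolding maximal_monotone_def monotone_op_def by blast
  show "monotone_op (perturb_op w T)"
    unfolding monotone_op_def perturb_op_def
  proof (intro allI impI)
    fix x y u v assume "u \<in> T (x - w)" "v \<in> T (y - w)"
    from mono[OF this] show "0 \<le> (x - y) \<bullet> (u - v)" by simp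
  qed
  fix x u assume rel: "\<forall>y v. v \<in> perturb_op w T y \<longrightarrow> 0 \<le> (x - y) \<bullet> (u - v)"
  have "0 \<le> (x - w - y) \<bullet> (u - v)" if "v \<in> T y" for y v
    using rel[rule_format, of v "y + w"] that by (simp add: perturb_op_def algebra_simps)
  then show "u \<in> perturb_op w T x"
    using T unfolding maximal_monotone_iff perturb_op_def by blast
qed

text \<open>Duality: the minimum over \<open>x\<close> of a convex combination of the functions
  \<open>\<lambda>x. (x - y) \<bullet> (x + v)\<close> is the concave function \<open>h\<close> below, evaluated at the corresponding
  point of the convex hull, and monotonicity makes \<open>h\<close> nonpositive. Although the hull need not be
  compact, strong concavity of \<open>h\<close> in \<open>y - v\<close> makes maximizing sequences converge in that
  variable.\<close>

lemma monotone_set_solution: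
  fixes G :: "('a::{real_inner, complete_space} \<times> 'a) set"
  assumes mono: "\<And>y v y' v'. (y, v) \<in> G \<Longrightarrow> (y', v') \<in> G \<Longrightarrow> 0 \<le> (y - y') \<bullet> (v - v')"
  shows "\<exists>x. \<forall>(y, v) \<in> G. (x - y) \<bullet> (x + v) \<le> 0"
proof (cases "G = {}")
  case False
  \<comment> \<open>The extra coordinate \<open>y \<bullet> v\<close> makes \<open>(x - y) \<bullet>
    (x + v) = x \<bullet> x - x \<bullet> (y - v) - y \<bullet> v\<close> affine in the lifted point
    for fixed \<open>x\<close>, so it extends to the convex hull.\<close>
  define g :: "'a \<times> 'a \<Rightarrow> 'a \<times> 'a \<times> real" where "g = (\<lambda>(y, v). (y, v, y \<bullet> v))"
  define W where "W = convex hull (g ` G)"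
  have gW: "g w \<in> W" if "w \<in> G" for w
    unfolding W_def using that by (intro hull_inc imageI)
  have "W \<noteq> {}" using False gW by blast
  have convW: "(1 - t) *\<^sub>R w + t *\<^sub>R w' \<in> W" if "w \<in> W" "w' \<in> W" "0 \<le> t" "t \<le> 1" for w w' t
    using convexD_alt[OF convex_convex_hull, of w "g ` G" w' t] that unfolding W_def by blast
  have affine_ge: "0 \<le> \<phi> w"
    if "\<And>w. w \<in> g ` G \<Longrightarrow> 0 \<le> \<phi> w"
      and "\<And>w w' t. \<phi> ((1 - t) *\<^sub>R w + t *\<^sub>R w') = (1 - t) * \<phi> w + t * \<phi> w'"
      and "w \<in> W" for \<phi> :: "'a \<times> 'a \<times> real \<Rightarrow> real" and w
  proof -
    have "convex {w. 0 \<le> \<phi> w}"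
      unfolding convex_alt using that(2) by simp
    then have "W \<subseteq> {w. 0 \<le> \<phi> w}"
      unfolding W_def using that(1) by (intro hull_minimal) auto
    then show ?thesis using that(3) by blast
  qed
  \<comment> \<open>On lifted graph points \<open>B\<close> equals
    \<open>(y - y') \<bullet> (v - v')\<close>, and it is affine in each argument. Nonnegativity
    thus passes from the graph to the hull one argument at a time.\<close>
  define B :: "'a \<times> 'a \<times> real \<Rightarrow> 'a \<times> 'a \<times> real \<Rightarrow> real" where
    "B = (\<lambda>(y, v, b) (y', v', b'). b + b' - y \<bullet> v' - y' \<bullet> v)"
  have B_affine: "B ((1 - t) *\<^sub>R w + t *\<^sub>R w') w'' = (1 - t) * B w w'' + t * B w' w''" for t w w' w''
    by (cases w; cases w'; cases w'') (simp add: B_def inner_simps algebra_simps)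
  have B_sym: "B w w' = B w' w" for w w'
    by (cases w; cases w') (simp add: B_def)
  have B1: "0 \<le> B w w'" if "w \<in> g ` G" "w' \<in> g ` G" for w w'
    using that mono by (force simp: B_def g_def inner_simps inner_commute)
  have B2: "0 \<le> B w w'" if "w \<in> W" "w' \<in> g ` G" for w w'
    using affine_ge[of "\<lambda>w. B w w'", OF _ B_affine that(1)] B1 that(2) by blast
  have B3: "0 \<le> B w w'" if "w \<in> W" "w' \<in> W" for w w'
    using affine_ge[of "\<lambda>w. B w w'", OF _ B_affine that(1)] B2[OF that(2)] B_sym[of w'] by metis
  define d :: "'a \<times> 'a \<times> real \<Rightarrow> 'a" where "d = (\<lambda>(y, v, b). y - v)"
  \<comment> \<open>This is the minimum over \<open>x\<close> of
    \<open>x \<bullet> x - x \<bullet> d w - snd (snd w)\<close>, attained at half of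
    \<open>d w\<close>.\<close>
  define h :: "'a \<times> 'a \<times> real \<Rightarrow> real" where "h w = - (norm (d w))\<^sup>2 / 4 - snd (snd w)" for w
  have h_conv: "h ((1 - t) *\<^sub>R w + t *\<^sub>R w') =
      (1 - t) * h w + t * h w' + t * (1 - t) / 4 * (norm (d w - d w'))\<^sup>2" for t w w'
  proof -
    have "d ((1 - t) *\<^sub>R w + t *\<^sub>R w') = (1 - t) *\<^sub>R d w + t *\<^sub>R d w'"
      by (cases w; cases w') (simp add: d_def algebra_simps)
    then show ?thesis
      unfolding h_def by (simp only: norm_convex_combination_power2) (simp add: field_simps)
  qed
  have h_le: "h w \<le> 0" if "w \<in> W" for w
  proof -
    obtain y v b where w: "w = (y, v, b)" by (cases w)
    \<comment> \<open>Nonnegativity of \<open>B\<close> on the diagonal says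
      \<open>y \<bullet> v \<le> b\<close>.\<close>
    have "h w \<le> - (norm (y - v))\<^sup>2 / 4 - y \<bullet> v"
      using B3[OF that that] by (simp add: w B_def h_def d_def)
    also have "\<dots> = - (norm (y + v))\<^sup>2 / 4"
      by (simp add: power2_norm_eq_inner inner_simps inner_commute field_simps)
    finally show ?thesis by (simp add: order_trans)
  qed
  define s where "s = (SUP w\<in>W. h w)"
  have bdd: "bdd_above (h ` W)" using h_le by (intro bdd_aboveI2)
  have h_s: "h w \<le> s" if "w \<in> W" for w
    unfolding s_def using bdd that by (rule cSUP_upper2[OF _ _ order_refl])
  have s_le: "s \<le> 0" unfolding s_def using \<open>W \<noteq> {}\<close> h_le by (rule cSUP_least)
  have "\<exists>w\<in>W. s - 1 / real (Suc n) < h w" for n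
    using less_cSUP_iff[OF \<open>W \<noteq> {}\<close> bdd, of "s - 1 / real (Suc n)"] by (simp add: s_def)
  then obtain w where w: "\<And>n. w n \<in> W" "\<And>n. s - 1 / real (Suc n) < h (w n)" by metis
  \<comment> \<open>The value of \<open>h\<close> at the midpoint is at most \<open>s\<close>. This
    bounds one sixteenth of the left side by half the sum of the two errors, hence the factor
    8.\<close>
  have "(norm (d (w m) - d (w n)))\<^sup>2 \<le> 8 * (1 / real (Suc m) + 1 / real (Suc n))" for m n
    using h_s[OF convW[of "w m" "w n" "1/2"]] w(1)[of m] w(1)[of n] w(2)[of m] w(2)[of n]
    unfolding h_conv by simp
  then obtain a where a: "(\<lambda>n. d (w n)) \<longlonglongrightarrow> a"
    using Cauchy_convergent Cauchy_if_power2_bound convergent_def by metis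
  \<comment> \<open>Half the limit of \<open>d (w n)\<close> is the limit of the inner minimizers,
    hence the candidate solution.\<close>
  have "((1 / 2) *\<^sub>R a - y) \<bullet> ((1 / 2) *\<^sub>R a + v) \<le> 0" if yv: "(y, v) \<in> G" for y v
  proof -
    let ?w = "g (y, v)"
    have eps: "(\<lambda>n. 1 / real (Suc n)) \<longlonglongrightarrow> 0"
      using LIMSEQ_inverse_real_of_nat by (simp add: inverse_eq_divide)
    \<comment> \<open>First-order optimality: move from \<open>w n\<close> by a fraction
      \<open>t\<close> toward the lifted graph point, let \<open>n\<close> tend to infinity, cancel
      and divide by \<open>t\<close>. Letting \<open>t\<close> tend to 0 afterwards removes the
      factor \<open>1 - t\<close>.\<close>
    have step: "h ?w + (1 - t) / 4 * (norm (a - d ?w))\<^sup>2 \<le> s" if t: "0 < t" "t < 1" for t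
    proof -
      have "(1 - t) * (s - 1 / real (Suc n)) + t * h ?w
          + t * (1 - t) / 4 * (norm (d (w n) - d ?w))\<^sup>2 \<le> s" for n
      proof -
        have "(1 - t) * (s - 1 / real (Suc n)) \<le> (1 - t) * h (w n)"
          using w(2)[of n] t by (intro mult_left_mono) auto
        moreover have "h ((1 - t) *\<^sub>R w n + t *\<^sub>R ?w) \<le> s"
          using t by (intro h_s convW w gW yv) auto
        ultimately show ?thesis unfolding h_conv by linarith
      qed
      moreover have "(\<lambda>n. (1 - t) * (s - 1 / real (Suc n)) + t * h ?w
          + t * (1 - t) / 4 * (norm (d (w n) - d ?w))\<^sup>2)
        \<longlonglongrightarrow> (1 - t) * (s - 0) + t * h ?w + t * (1 - t) / 4 * (norm (a - d ?w))\<^sup>2"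
        by (intro tendsto_intros a eps)
      ultimately have "(1 - t) * (s - 0) + t * h ?w + t * (1 - t) / 4 * (norm (a - d ?w))\<^sup>2 \<le> s"
        by (intro LIMSEQ_le_const2) auto
      then have "t * (h ?w + (1 - t) / 4 * (norm (a - d ?w))\<^sup>2) \<le> t * s"
        by (simp add: algebra_simps)
      then show ?thesis using t by simp
    qed
    have "((\<lambda>t. h ?w + (1 - t) / 4 * (norm (a - d ?w))\<^sup>2) \<longlongrightarrow>
        h ?w + (1 - 0) / 4 * (norm (a - d ?w))\<^sup>2) (at_right (0::real))"
      by (intro tendsto_intros) auto
    moreover have "\<forall>\<^sub>F t in at_right (0::real). h ?w + (1 - t) / 4 * (norm (a - d ?w))\<^sup>2 \<le> s"
      unfolding eventually_at_right_field by (intro exI[of _ 1] conjI allI impI step) simp_all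
    ultimately have "h ?w + (1 - 0) / 4 * (norm (a - d ?w))\<^sup>2 \<le> s"
      by (intro tendsto_upperbound[of _ _ "at_right (0::real)"]) auto
    then have "h ?w + (norm (a - d ?w))\<^sup>2 / 4 \<le> 0"
      using s_le by simp
    moreover have "h ?w + (norm (a - d ?w))\<^sup>2 / 4 = ((1 / 2) *\<^sub>R a - y) \<bullet> ((1 / 2) *\<^sub>R a + v)"
      by (simp add: h_def d_def g_def power2_norm_eq_inner inner_simps inner_commute field_simps)
    ultimately show ?thesis by simp
  qed
  then show ?thesis by blast
qed auto

text \<open>With the graph shifted by \<open>z\<close> in the second coordinate,
  \<open>monotone_set_solution\<close> yields an \<open>x\<close> such that
  \<open>(x, z - x)\<close> is monotonically related to the graph of \<open>T\<close>; maximality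
  puts this pair into the graph.\<close>

theorem Minty:
  fixes T :: "'a::{real_inner, complete_space} \<Rightarrow> 'a set"
  assumes T: "maximal_monotone T"
  shows "\<exists>p. z - p \<in> T p"
proof -
  define G where "G = {(y, v - z) | y v. v \<in> T y}"
  have "\<exists>x. \<forall>(y, v) \<in> G. (x - y) \<bullet> (x + v) \<le> 0"
  proof (rule monotone_set_solution)
    show "0 \<le> (y - y') \<bullet> (v - v')" if "(y, v) \<in> G" "(y', v') \<in> G" for y v y' v'
      using T that unfolding maximal_monotone_def monotone_op_def G_def by force
  qed
  then obtain x where x: "(x - y) \<bullet> (x + (v - z)) \<le> 0" if "v \<in> T y" for y v
    unfolding G_def by blast
  have "0 \<le> (x - y) \<bullet> (z - x - v)" if "v \<in> T y" for y v
    using x[OF that] by (simp add: inner_simps algebra_simps)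
  then show ?thesis
    using T unfolding maximal_monotone_iff by blast
qed

text \<open>For two solutions, the monotonicity pairing equals minus the squared norm of their
  difference. The lemma is stated for monotone operators so that it covers the scaled sum of the
  \<open>A i\<close>, for which only monotonicity is established.\<close>

lemma resolvent_eqI:
  assumes T: "monotone_op T" and p: "z - p \<in> T p"
  shows "resolvent T z = p"
  unfolding resolvent_def
proof (rule the_equality)
  fix p' assume "z - p' \<in> T p'"
  then have "0 \<le> (p' - p) \<bullet> ((z - p') - (z - p))"
    using T p unfolding monotone_op_def by blast
  also have "\<dots> = - ((p' - p) \<bullet> (p' - p))" by (simp add: inner_simps inner_commute)
  finally show "p' = p" by (simp flip: power2_norm_eq_inner)
qed (rule p)

lemma resolvent_maximal_monotone:
  fixes T :: "'a::{real_inner, complete_space} \<Rightarrow> 'a set"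
  assumes T: "maximal_monotone T"
  shows "z - resolvent T z \<in> T (resolvent T z)"
proof -
  obtain p where "z - p \<in> T p" using Minty[OF T] by blast
  moreover from this have "resolvent T z = p"
    using T by (intro resolvent_eqI) (auto simp: maximal_monotone_def)
  ultimately show ?thesis by simp
qed

lemma resolvent_firmly_nonexpansive:
  fixes T :: "'a::{real_inner, complete_space} \<Rightarrow> 'a set"
  assumes T: "maximal_monotone T"
  shows "(norm (resolvent T u - resolvent T v))\<^sup>2 \<le> (resolvent T u - resolvent T v) \<bullet> (u - v)"
proof -
  have "0 \<le> (resolvent T u - resolvent T v) \<bullet> ((u - resolvent T u) - (v - resolvent T v))"
    using T resolvent_maximal_monotone[OF T] unfolding maximal_monotone_def monotone_op_def by blast
  then show ?thesis by (simp add: power2_norm_eq_inner inner_simps algebra_simps)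
qed

lemma monotone_op_sum:
  assumes "\<And>i. i \<in> I \<Longrightarrow> monotone_op (A i)"
  shows "monotone_op (sum_op A I)"
  unfolding monotone_op_def sum_op_def
proof (clarify)
  fix x y u v assume "\<forall>i\<in>I. u i \<in> A i x" "\<forall>i\<in>I. v i \<in> A i y"
  then have "0 \<le> (\<Sum>i\<in>I. (x - y) \<bullet> (u i - v i))"
    using assms unfolding monotone_op_def by (intro sum_nonneg) blast
  then show "0 \<le> (x - y) \<bullet> (sum u I - sum v I)"
    by (simp add: inner_sum_right flip: sum_subtractf)
qed

section \<open>Asymptotic centers and Krasnoselskii--Mann iteration in finite products\<close>

text \<open>The product space indexed by \<open>I\<close> is modelled by functions that only matter on \<open>I\<close>.\<close>

definition fam_dist :: "'i set \<Rightarrow> ('i \<Rightarrow> 'a::real_normed_vector) \<Rightarrow> ('i \<Rightarrow> 'a) \<Rightarrow> real" where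
  "fam_dist I u v = L2_set (\<lambda>i. norm (u i - v i)) I"

lemma fam_dist_nonneg [simp]: "0 \<le> fam_dist I u v"
  by (simp add: fam_dist_def)

lemma fam_dist_power2: "(fam_dist I u v)\<^sup>2 = (\<Sum>i\<in>I. (norm (u i - v i))\<^sup>2)"
  by (simp add: fam_dist_def L2_set_def sum_nonneg)

lemma fam_dist_commute: "fam_dist I u v = fam_dist I v u"
  by (simp add: fam_dist_def norm_minus_commute)

lemma fam_dist_triangle: "fam_dist I u w \<le> fam_dist I u v + fam_dist I v w"
proof -
  have "fam_dist I u w \<le> L2_set (\<lambda>i. norm (u i - v i) + norm (v i - w i)) I"
    unfolding fam_dist_def
    by (intro L2_set_mono order_trans[OF _ norm_triangle_ineq]) auto
  also have "\<dots> \<le> fam_dist I u v + fam_dist I v w"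
    unfolding fam_dist_def by (rule L2_set_triangle_ineq)
  finally show ?thesis .
qed

lemma norm_le_fam_dist: "finite I \<Longrightarrow> i \<in> I \<Longrightarrow> norm (u i - v i) \<le> fam_dist I u v"
  unfolding fam_dist_def by (rule member_le_L2_set)

lemma fam_dist_eq_0_iff: "finite I \<Longrightarrow> fam_dist I u v = 0 \<longleftrightarrow> (\<forall>i\<in>I. u i = v i)"
  by (simp add: fam_dist_def L2_set_eq_0_iff)

lemma fam_dist_cong:
  "(\<And>i. i \<in> I \<Longrightarrow> u i = u' i) \<Longrightarrow> (\<And>i. i \<in> I \<Longrightarrow> v i = v' i) \<Longrightarrow> fam_dist I u v = fam_dist I u' v'"
  unfolding fam_dist_def by (intro L2_set_cong) auto

lemma fam_dist_scaleR:
  assumes "\<And>i. i \<in> I \<Longrightarrow> u i - v i = c *\<^sub>R (u' i - v' i)" "c \<ge> 0"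
  shows "fam_dist I u v = c * fam_dist I u' v'"
proof -
  have "fam_dist I u v = L2_set (\<lambda>i. c * norm (u' i - v' i)) I"
    unfolding fam_dist_def using assms by (intro L2_set_cong) auto
  then show ?thesis using assms(2) by (simp add: fam_dist_def L2_set_right_distrib)
qed

lemma fam_dist_convex_combination:
  fixes u v w :: "'i \<Rightarrow> 'a::real_inner"
  shows "(fam_dist I w (\<lambda>i. (1 - t) *\<^sub>R u i + t *\<^sub>R v i))\<^sup>2 =
    (1 - t) * (fam_dist I w u)\<^sup>2 + t * (fam_dist I w v)\<^sup>2 - t * (1 - t) * (fam_dist I u v)\<^sup>2"
proof -
  have "(norm (w i - ((1 - t) *\<^sub>R u i + t *\<^sub>R v i)))\<^sup>2 =
    (1 - t) * (norm (w i - u i))\<^sup>2 + t * (norm (w i - v i))\<^sup>2 - t * (1 - t) * (norm (u i - v i))\<^sup>2" for i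
    using norm_convex_combination_power2[of t "w i - u i" "w i - v i"]
    by (simp add: algebra_simps norm_minus_commute)
  then show ?thesis
    by (simp add: fam_dist_power2 sum.distrib sum_subtractf sum_distrib_left)
qed

text \<open>That is, \<open>c\<close> minimizes \<open>u \<mapsto> limsup (fam_dist I (z n) u)\<^sup>2\<close> and \<open>s\<close> is the minimum, stated
  so that no extended reals are needed.\<close>

definition asymptotic_center ::
    "'i set \<Rightarrow> ('n \<Rightarrow> 'i \<Rightarrow> 'a::real_normed_vector) \<Rightarrow> 'n filter \<Rightarrow> ('i \<Rightarrow> 'a) \<Rightarrow> real \<Rightarrow> bool" where
  "asymptotic_center I z F c s \<longleftrightarrow>
     (\<forall>t>s. \<forall>\<^sub>F n in F. (fam_dist I (z n) c)\<^sup>2 \<le> t) \<and>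
     (\<forall>u t. (\<forall>\<^sub>F n in F. (fam_dist I (z n) u)\<^sup>2 \<le> t) \<longrightarrow> s \<le> t)"

text \<open>The squared distance to the midpoint is eventually at most the mean of \<open>a\<close>
  and \<open>b\<close> minus a quarter of the squared distance from \<open>u\<close> to
  \<open>v\<close>, and no such eventual bound lies below \<open>s\<close>.\<close>

lemma asymptotic_midpoint:
  fixes z :: "'n \<Rightarrow> 'i \<Rightarrow> 'a::real_inner"
  assumes "\<forall>\<^sub>F n in F. (fam_dist I (z n) u)\<^sup>2 \<le> a" "\<forall>\<^sub>F n in F. (fam_dist I (z n) v)\<^sup>2 \<le> b"
    and s: "\<And>u t. \<forall>\<^sub>F n in F. (fam_dist I (z n) u)\<^sup>2 \<le> t \<Longrightarrow> s \<le> t"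
  shows "(fam_dist I u v)\<^sup>2 \<le> 2 * (a - s) + 2 * (b - s)"
proof -
  have "\<forall>\<^sub>F n in F. (fam_dist I (z n) (\<lambda>i. (1 - 1 / 2) *\<^sub>R u i + (1 / 2) *\<^sub>R v i))\<^sup>2
      \<le> (a + b) / 2 - (fam_dist I u v)\<^sup>2 / 4"
    using assms(1,2) unfolding fam_dist_convex_combination
    by eventually_elim (simp add: field_simps)
  from s[OF this] show ?thesis by (simp add: field_simps)
qed

lemma asymptotic_center_unique:
  fixes z :: "'n \<Rightarrow> 'i \<Rightarrow> 'a::real_inner"
  assumes "asymptotic_center I z F c s" "\<And>t. t > s \<Longrightarrow> \<forall>\<^sub>F n in F. (fam_dist I (z n) c')\<^sup>2 \<le> t"
  shows "fam_dist I c c' = 0"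
proof -
  have "(fam_dist I c c')\<^sup>2 \<le> 0 + e" if "e > 0" for e
  proof -
    \<comment> \<open>The midpoint estimate doubles each error, so two errors of
      \<open>e / 4\<close> add up to \<open>e\<close>.\<close>
    have "s < s + e / 4" using that by simp
    then have "\<forall>\<^sub>F n in F. (fam_dist I (z n) c)\<^sup>2 \<le> s + e / 4"
      "\<forall>\<^sub>F n in F. (fam_dist I (z n) c')\<^sup>2 \<le> s + e / 4"
      using assms unfolding asymptotic_center_def by blast+
    then have "(fam_dist I c c')\<^sup>2 \<le> 2 * (s + e / 4 - s) + 2 * (s + e / 4 - s)"
      by (rule asymptotic_midpoint) (use assms(1) asymptotic_center_def in blast)
    then show ?thesis by simp
  qed
  then have "(fam_dist I c c')\<^sup>2 \<le> 0"
    by (rule field_le_epsilon)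
  then show ?thesis by simp
qed

text \<open>Near-minimizers form a Cauchy sequence by the midpoint estimate, and their limit attains
  the infimum. The filter is arbitrary so that subfilters of the iteration are covered.\<close>

lemma asymptotic_center_exists:
  fixes z :: "'n \<Rightarrow> 'i \<Rightarrow> 'a::{real_inner, complete_space}"
  assumes I: "finite I" and F: "F \<noteq> bot" and bdd: "\<forall>\<^sub>F n in F. fam_dist I (z n) u0 \<le> C"
  shows "\<exists>c s. asymptotic_center I z F c s"
proof -
  define S where "S = {t. \<exists>u. \<forall>\<^sub>F n in F. (fam_dist I (z n) u)\<^sup>2 \<le> t}"
  define s where "s = Inf S"
  have S0: "0 \<le> t" if t: "t \<in> S" for t
  proof -
    obtain u where "\<forall>\<^sub>F n in F. (fam_dist I (z n) u)\<^sup>2 \<le> t" using t S_def by blast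
    then have "\<forall>\<^sub>F n in F. 0 \<le> t" by eventually_elim (meson order_trans zero_le_power2)
    then show ?thesis using F by (simp add: eventually_const_iff)
  qed
  have "\<forall>\<^sub>F n in F. (fam_dist I (z n) u0)\<^sup>2 \<le> C\<^sup>2"
    using bdd by eventually_elim (simp add: power_mono)
  then have "S \<noteq> {}" unfolding S_def by blast
  have bddS: "bdd_below S" using S0 by (intro bdd_belowI)
  have s_le: "s \<le> t" if "\<forall>\<^sub>F n in F. (fam_dist I (z n) u)\<^sup>2 \<le> t" for u t
    unfolding s_def using that bddS by (intro cInf_lower) (auto simp: S_def)
  have "s \<ge> 0" unfolding s_def using \<open>S \<noteq> {}\<close> S0 by (rule cInf_greatest)
  have near: "\<exists>u. \<forall>\<^sub>F n in F. (fam_dist I (z n) u)\<^sup>2 \<le> t" if t: "t > s" for t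
  proof -
    obtain t' where "t' \<in> S" "t' < t"
      using cInf_lessD[OF \<open>S \<noteq> {}\<close>] t unfolding s_def by blast
    then obtain u where "\<forall>\<^sub>F n in F. (fam_dist I (z n) u)\<^sup>2 \<le> t'" unfolding S_def by blast
    then have "\<forall>\<^sub>F n in F. (fam_dist I (z n) u)\<^sup>2 \<le> t"
      by eventually_elim (use \<open>t' < t\<close> in linarith)
    then show ?thesis by blast
  qed
  have "\<forall>k. \<exists>u. \<forall>\<^sub>F n in F. (fam_dist I (z n) u)\<^sup>2 \<le> s + 1 / real (Suc k)"
    by (intro allI near) simp
  then obtain u where u: "\<And>k. \<forall>\<^sub>F n in F. (fam_dist I (z n) (u k))\<^sup>2 \<le> s + 1 / real (Suc k)"
    by metis
  have diff: "(fam_dist I (u k) (u l))\<^sup>2 \<le> 2 * (1 / real (Suc k) + 1 / real (Suc l))" for k l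
    using asymptotic_midpoint[OF u[of k] u[of l] s_le] by simp
  have "\<exists>c. (\<lambda>k. u k i) \<longlonglongrightarrow> c" if i: "i \<in> I" for i
  proof -
    have "(norm (u k i - u l i))\<^sup>2 \<le> 2 * (1 / real (Suc k) + 1 / real (Suc l))" for k l
      using norm_le_fam_dist[OF I i] by (intro order_trans[OF power_mono diff]) auto
    then have "Cauchy (\<lambda>k. u k i)" by (rule Cauchy_if_power2_bound)
    then show ?thesis using Cauchy_convergent convergent_def by blast
  qed
  then obtain c where c: "\<And>i. i \<in> I \<Longrightarrow> (\<lambda>k. u k i) \<longlonglongrightarrow> c i" by metis
  have "(\<lambda>k. (fam_dist I (u k) c)\<^sup>2) \<longlonglongrightarrow> (\<Sum>i\<in>I. (norm (c i - c i))\<^sup>2)"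
    unfolding fam_dist_power2 by (intro tendsto_intros c)
  then have uc: "(\<lambda>k. fam_dist I (u k) c) \<longlonglongrightarrow> 0"
    using tendsto_real_sqrt[of "\<lambda>k. (fam_dist I (u k) c)\<^sup>2" 0] by simp
  have "\<forall>\<^sub>F n in F. (fam_dist I (z n) c)\<^sup>2 \<le> t" if t: "t > s" for t
  proof -
    \<comment> \<open>By the triangle inequality through \<open>u k\<close>, this sum eventually
      bounds the distance from \<open>z n\<close> to \<open>c\<close>; its square falls below
      \<open>t\<close> for large \<open>k\<close>.\<close>
    have "(\<lambda>k. (sqrt (s + 1 / real (Suc k)) + fam_dist I (u k) c)\<^sup>2) \<longlonglongrightarrow> (sqrt (s + 0) + 0)\<^sup>2"
      using LIMSEQ_inverse_real_of_nat
      by (intro tendsto_intros uc) (simp add: inverse_eq_divide)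
    then have "\<forall>\<^sub>F k in sequentially. (sqrt (s + 1 / real (Suc k)) + fam_dist I (u k) c)\<^sup>2 < t"
      by (rule order_tendstoD) (use t \<open>s \<ge> 0\<close> in simp)
    then obtain k where k: "(sqrt (s + 1 / real (Suc k)) + fam_dist I (u k) c)\<^sup>2 < t"
      unfolding eventually_sequentially by blast
    show ?thesis using u[of k]
    proof eventually_elim
      case (elim n)
      have "fam_dist I (z n) (u k) \<le> sqrt (s + 1 / real (Suc k))"
        using elim by (rule real_le_rsqrt)
      then have "fam_dist I (z n) c \<le> sqrt (s + 1 / real (Suc k)) + fam_dist I (u k) c"
        using fam_dist_triangle[of I "z n" c "u k"] by linarith
      then show ?case using k power_mono[of "fam_dist I (z n) c" _ 2] by fastforce
    qed
  qed
  then show ?thesis unfolding asymptotic_center_def using s_le by blast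
qed

text \<open>Nonexpansiveness and vanishing residuals give \<open>T c\<close> an asymptotic radius no
  larger than that of \<open>c\<close>, so uniqueness identifies the two.\<close>

lemma asymptotic_center_fixed:
  fixes z :: "'n \<Rightarrow> 'i \<Rightarrow> 'a::real_inner"
  assumes c: "asymptotic_center I z F c s" and F: "F \<noteq> bot"
    and nonexp: "\<And>u v. fam_dist I (T u) (T v) \<le> fam_dist I u v"
    and approx: "((\<lambda>n. fam_dist I (z n) (T (z n))) \<longlongrightarrow> 0) F"
  shows "fam_dist I c (T c) = 0"
proof (rule asymptotic_center_unique[OF c])
  have "0 \<le> s"
  proof (rule field_le_epsilon)
    fix e :: real assume "e > 0"
    then have "\<forall>\<^sub>F n in F. (fam_dist I (z n) c)\<^sup>2 \<le> s + e"
      using c unfolding asymptotic_center_def by simp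
    then have "\<forall>\<^sub>F n in F. 0 \<le> s + e" by eventually_elim (meson order_trans zero_le_power2)
    then show "0 \<le> s + e" using F by (simp add: eventually_const_iff)
  qed
  fix t assume t: "t > s"
  \<comment> \<open>A level strictly between \<open>s\<close> and \<open>t\<close> leaves the room
    \<open>sqrt t - sqrt m\<close> for the residual.\<close>
  define m where "m = (s + t) / 2"
  have m: "s < m" "m < t" "0 < m" using t \<open>0 \<le> s\<close> by (auto simp: m_def)
  have ev: "\<forall>\<^sub>F n in F. (fam_dist I (z n) c)\<^sup>2 \<le> m"
    using c m unfolding asymptotic_center_def by blast
  have "\<forall>\<^sub>F n in F. fam_dist I (z n) (T (z n)) < sqrt t - sqrt m"
    by (rule order_tendstoD[OF approx]) (use m in simp)
  with ev show "\<forall>\<^sub>F n in F. (fam_dist I (z n) (T c))\<^sup>2 \<le> t"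
  proof eventually_elim
    case (elim n)
    have "fam_dist I (z n) c \<le> sqrt m" using elim(1) by (rule real_le_rsqrt)
    then have "fam_dist I (z n) (T c) \<le> sqrt t"
      using elim(2) nonexp[of "z n" c] fam_dist_triangle[of I "z n" "T c" "T (z n)"] by linarith
    then have "(fam_dist I (z n) (T c))\<^sup>2 \<le> (sqrt t)\<^sup>2" by (intro power_mono) auto
    then show ?case using m by simp
  qed
qed

section \<open>Weak convergence of the iterates\<close>

lemma fam_dist_update_power2:
  fixes u c :: "'i \<Rightarrow> 'a::real_inner"
  assumes "finite I" "j \<in> I"
  shows "(fam_dist I u (c(j := c j + t *\<^sub>R y)))\<^sup>2 =
    (fam_dist I u c)\<^sup>2 - 2 * t * ((u j - c j) \<bullet> y) + t\<^sup>2 * (norm y)\<^sup>2"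
proof -
  have eq: "(\<Sum>i\<in>I - {j}. (norm (u i - (c(j := c j + t *\<^sub>R y)) i))\<^sup>2) = (\<Sum>i\<in>I - {j}. (norm (u i - c i))\<^sup>2)"
    by (rule sum.cong) auto
  have "(norm (u j - (c j + t *\<^sub>R y)))\<^sup>2 = (norm (u j - c j))\<^sup>2 - 2 * t * ((u j - c j) \<bullet> y) + t\<^sup>2 * (norm y)\<^sup>2"
    by (simp only: power2_norm_eq_inner)
      (simp add: inner_simps inner_commute power2_eq_square algebra_simps)
  then show ?thesis
    using assms by (simp add: fam_dist_power2 sum.remove[of I j] eq)
qed

text \<open>If \<open>z n i\<close> did not converge weakly to \<open>c i\<close>, then along a subfilter a small step from \<open>c\<close>
  would decrease the asymptotic radius; but the asymptotic center along the subfilter is also a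
  fixed point, and distances to fixed points have the same limit along every subfilter.\<close>

lemma Opial_weak_convergence:
  fixes z :: "nat \<Rightarrow> 'i \<Rightarrow> 'a::{real_inner, complete_space}"
  assumes I: "finite I"
    and nonexp: "\<And>u v. fam_dist I (T u) (T v) \<le> fam_dist I u v"
    and approx: "(\<lambda>n. fam_dist I (z n) (T (z n))) \<longlonglongrightarrow> 0"
    and fix0: "fam_dist I w0 (T w0) = 0"
    and lim: "\<And>w. fam_dist I w (T w) = 0 \<Longrightarrow> convergent (\<lambda>n. (fam_dist I (z n) w)\<^sup>2)"
  shows "\<exists>c. fam_dist I c (T c) = 0 \<and> (\<forall>i\<in>I. weakly_converges_to (\<lambda>n. z n i) (c i))"
proof -
  have "Bseq (\<lambda>n. (fam_dist I (z n) w0)\<^sup>2)"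
    using lim[OF fix0] by (rule convergent_imp_Bseq)
  then obtain K where K: "\<And>n. (fam_dist I (z n) w0)\<^sup>2 \<le> K" unfolding Bseq_def by auto
  have bdd: "fam_dist I (z n) w0 \<le> sqrt K" for n
    using K by (intro real_le_rsqrt)
  have center: "\<exists>c s. asymptotic_center I z F c s \<and> fam_dist I c (T c) = 0"
    if F: "F \<noteq> bot" "F \<le> sequentially" for F
    using asymptotic_center_exists[OF I F(1), of z w0 "sqrt K"] bdd
      asymptotic_center_fixed[where T = T, OF _ F(1) nonexp tendsto_mono[OF F(2) approx]]
    by fastforce
  obtain c s where c: "asymptotic_center I z sequentially c s" "fam_dist I c (T c) = 0"
    using center[of sequentially] by auto
  obtain L where L: "(\<lambda>n. (fam_dist I (z n) c)\<^sup>2) \<longlonglongrightarrow> L"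
    using lim[OF c(2)] convergent_def by blast
  \<comment> \<open>Being the center along the whole sequence, \<open>c\<close> has the least
    limiting squared distance among fixed points: \<open>L \<le> s \<le> L'\<close>.\<close>
  have L_min: "L \<le> L'"
    if "fam_dist I w (T w) = 0" "(\<lambda>n. (fam_dist I (z n) w)\<^sup>2) \<longlonglongrightarrow> L'" for w L'
  proof -
    have "L \<le> s"
    proof (rule dense_ge)
      fix t assume "t > s"
      then have "\<forall>\<^sub>F n in sequentially. (fam_dist I (z n) c)\<^sup>2 \<le> t"
        using c(1) unfolding asymptotic_center_def by blast
      then show "L \<le> t" by (rule tendsto_upperbound[OF L]) simp
    qed
    also have "s \<le> L'"
    proof (rule dense_ge)
      fix t assume "t > L'"
      then have "\<forall>\<^sub>F n in sequentially. (fam_dist I (z n) w)\<^sup>2 < t"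
        by (rule order_tendstoD[OF that(2)])
      then have "\<forall>\<^sub>F n in sequentially. (fam_dist I (z n) w)\<^sup>2 \<le> t"
        by eventually_elim simp
      then show "s \<le> t" using c(1) unfolding asymptotic_center_def by blast
    qed
    finally show ?thesis .
  qed
  have upper: "\<forall>\<^sub>F n in sequentially. (z n j - c j) \<bullet> y < e" if j: "j \<in> I" and e: "e > 0" for j y e
  proof (rule ccontr)
    assume neg: "\<not> ?thesis"
    \<comment> \<open>On this subfilter the pairing with \<open>y\<close> stays at least
      \<open>e\<close>; it is nontrivial because the bound fails infinitely often.\<close>
    define F where "F = inf sequentially (principal {n. e \<le> (z n j - c j) \<bullet> y})"
    have "F \<noteq> bot"
      using neg unfolding F_def trivial_limit_def eventually_inf_principal
      by (simp add: not_le)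
    moreover have "F \<le> sequentially" by (simp add: F_def)
    ultimately obtain c' s' where c': "asymptotic_center I z F c' s'" "fam_dist I c' (T c') = 0"
      using center by blast
    obtain L' where L': "(\<lambda>n. (fam_dist I (z n) c')\<^sup>2) \<longlonglongrightarrow> L'"
      using lim[OF c'(2)] convergent_def by blast
    have "L' \<le> s'"
    proof (rule dense_ge)
      fix t assume "t > s'"
      then have "\<forall>\<^sub>F n in F. (fam_dist I (z n) c')\<^sup>2 \<le> t"
        using c'(1) unfolding asymptotic_center_def by blast
      then show "L' \<le> t"
        using tendsto_upperbound[OF tendsto_mono[OF \<open>F \<le> sequentially\<close> L']] \<open>F \<noteq> bot\<close> by blast
    qed
    \<comment> \<open>The linear term lowers the squared distance by at least
      \<open>2 * t * e\<close>, and the quadratic term returns at most \<open>t * e\<close>. Half of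
      the net gain absorbs the error in approaching \<open>L\<close>. The summand 1 covers
      \<open>y = 0\<close>.\<close>
    define t where "t = e / ((norm y)\<^sup>2 + 1)"
    have pos: "(norm y)\<^sup>2 + 1 > 0" by (simp add: add_nonneg_pos)
    have t: "t > 0" "t * (norm y)\<^sup>2 \<le> e"
      using e pos by (auto simp: t_def field_simps)
    have "\<forall>\<^sub>F n in F. (fam_dist I (z n) c)\<^sup>2 < L + t * e / 2"
      using \<open>F \<le> sequentially\<close> order_tendstoD(2)[OF L, of "L + t * e / 2"] t e
      by (auto intro: filter_leD)
    moreover have "\<forall>\<^sub>F n in F. e \<le> (z n j - c j) \<bullet> y"
      unfolding F_def eventually_inf_principal by simp
    ultimately have "\<forall>\<^sub>F n in F. (fam_dist I (z n) (c(j := c j + t *\<^sub>R y)))\<^sup>2 \<le> L - t * e / 2"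
    proof eventually_elim
      case (elim n)
      have "t * e \<le> t * ((z n j - c j) \<bullet> y)"
        using elim(2) t(1) by simp
      moreover have "t\<^sup>2 * (norm y)\<^sup>2 \<le> t * e"
        using mult_left_mono[OF t(2), of t] t(1) by (simp add: power2_eq_square mult.assoc)
      ultimately show ?case
        using elim(1) unfolding fam_dist_update_power2[OF I j] by linarith
    qed
    \<comment> \<open>This closes the contradictory chain
      \<open>L \<le> L' \<le> s' \<le> L - t * e / 2\<close>.\<close>
    then have "s' \<le> L - t * e / 2"
      using c'(1) unfolding asymptotic_center_def by blast
    moreover have "t * e > 0" using t e by simp
    ultimately show False using \<open>L' \<le> s'\<close> L_min[OF c'(2) L'] by linarith
  qed
  have "weakly_converges_to (\<lambda>n. z n j) (c j)" if j: "j \<in> I" for j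
    unfolding weakly_converges_to_def
  proof (intro allI tendstoI)
    fix y :: 'a and e :: real assume e: "e > 0"
    \<comment> \<open>Testing with \<open>y\<close> and \<open>- y\<close> makes the one-sided bound
      two-sided.\<close>
    from upper[OF j e, of y] upper[OF j e, of "- y"]
    show "\<forall>\<^sub>F n in sequentially. dist (z n j \<bullet> y) (c j \<bullet> y) < e"
      by eventually_elim (simp add: dist_real_def inner_diff_left abs_less_iff)
  qed
  then show ?thesis using c(2) by blast
qed

text \<open>Each step lowers the squared distance to any fixed point by at least
  \<open>lam n * (1 - lam n)\<close> times the squared residual. Residuals decrease, so a positive
  limit would make the series of \<open>lam n * (1 - lam n)\<close> summable.\<close>

lemma Krasnoselskii_Mann:
  fixes z :: "nat \<Rightarrow> 'i \<Rightarrow> 'a::{real_inner, complete_space}"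
  assumes I: "finite I"
    and nonexp: "\<And>u v. fam_dist I (T u) (T v) \<le> fam_dist I u v"
    and fix0: "fam_dist I w0 (T w0) = 0"
    and lam01: "\<And>n. 0 \<le> lam n \<and> lam n \<le> 1"
    and lamdiv: "\<not> summable (\<lambda>n. lam n * (1 - lam n))"
    and rec: "\<And>n i. i \<in> I \<Longrightarrow> z (Suc n) i = (1 - lam n) *\<^sub>R z n i + lam n *\<^sub>R T (z n) i"
  shows "(\<lambda>n. fam_dist I (z n) (T (z n))) \<longlonglongrightarrow> 0"
    and "\<And>w n. fam_dist I w (T w) = 0 \<Longrightarrow> fam_dist I (z n) w \<le> fam_dist I (z 0) w"
    and "\<exists>c. fam_dist I c (T c) = 0 \<and> (\<forall>i\<in>I. weakly_converges_to (\<lambda>n. z n i) (c i))"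
proof -
  define R where "R n = fam_dist I (z n) (T (z n))" for n
  have fejer: "(fam_dist I (z (Suc n)) w)\<^sup>2 \<le> (fam_dist I (z n) w)\<^sup>2 - lam n * (1 - lam n) * (R n)\<^sup>2"
    if w: "fam_dist I w (T w) = 0" for w n
  proof -
    have "fam_dist I (T (z n)) w \<le> fam_dist I (z n) w"
      using nonexp[of "z n" w] fam_dist_triangle[of I "T (z n)" w "T w"] w
        fam_dist_commute[of I w "T w"] by linarith
    then have "lam n * (fam_dist I w (T (z n)))\<^sup>2 \<le> lam n * (fam_dist I w (z n))\<^sup>2"
      using lam01 by (intro mult_left_mono power_mono) (auto simp: fam_dist_commute)
    moreover have "fam_dist I (z (Suc n)) w = fam_dist I w (\<lambda>i. (1 - lam n) *\<^sub>R z n i + lam n *\<^sub>R T (z n) i)"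
      using rec by (subst fam_dist_commute) (auto intro!: fam_dist_cong)
    ultimately show ?thesis
      by (simp only: fam_dist_convex_combination R_def fam_dist_commute[of I "z n" w])
        (simp add: algebra_simps)
  qed
  have lamnn: "0 \<le> lam n * (1 - lam n)" for n using lam01 by simp
  have dec: "decseq (\<lambda>n. (fam_dist I (z n) w)\<^sup>2)" if w: "fam_dist I w (T w) = 0" for w
  proof (rule decseq_SucI)
    fix n
    have "0 \<le> lam n * (1 - lam n) * (R n)\<^sup>2" using lamnn by (rule mult_nonneg_nonneg) simp
    then show "(fam_dist I (z (Suc n)) w)\<^sup>2 \<le> (fam_dist I (z n) w)\<^sup>2"
      using fejer[OF w, of n] by linarith
  qed
  have conv: "convergent (\<lambda>n. (fam_dist I (z n) w)\<^sup>2)" if "fam_dist I w (T w) = 0" for w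
    by (rule decseq_convergent[OF dec[OF that], of 0]) (auto intro: convergentI)
  have R_dec: "decseq R"
  proof (rule decseq_SucI)
    fix n
    \<comment> \<open>The new iterate divides the segment from \<open>z n\<close> to
      \<open>T (z n)\<close> into pieces of length \<open>lam n * R n\<close> and
      \<open>(1 - lam n) * R n\<close>.\<close>
    have 1: "fam_dist I (z (Suc n)) (z n) = lam n * R n"
      unfolding R_def fam_dist_commute[of I "z n" "T (z n)"]
      using rec lam01 by (intro fam_dist_scaleR) (auto simp: algebra_simps)
    have 2: "fam_dist I (z (Suc n)) (T (z n)) = (1 - lam n) * R n"
      unfolding R_def
      using rec lam01 by (intro fam_dist_scaleR) (auto simp: algebra_simps)
    have "R (Suc n) \<le> fam_dist I (z (Suc n)) (T (z n)) + fam_dist I (T (z n)) (T (z (Suc n)))"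
      unfolding R_def by (rule fam_dist_triangle)
    also have "\<dots> \<le> (1 - lam n) * R n + lam n * R n"
      using nonexp[of "z n" "z (Suc n)"] 1 2 by (simp add: fam_dist_commute)
    finally show "R (Suc n) \<le> R n" by (simp add: algebra_simps)
  qed
  have R0: "0 \<le> R n" for n by (simp add: R_def)
  obtain l where l: "R \<longlonglongrightarrow> l" "\<And>n. l \<le> R n"
    using decseq_convergent[OF R_dec, of 0] R0 by auto
  have "l \<ge> 0" using R0 by (intro LIMSEQ_le_const[OF l(1)]) auto
  have "l = 0"
  proof (rule ccontr)
    assume "l \<noteq> 0"
    then have lpos: "l\<^sup>2 > 0" by simp
    \<comment> \<open>The decrease of the squared distance telescopes, with every residual bounded
      below by \<open>l\<close>.\<close>
    have "(\<Sum>k<n. lam k * (1 - lam k) * l\<^sup>2) \<le> (fam_dist I (z 0) w0)\<^sup>2 - (fam_dist I (z n) w0)\<^sup>2" for n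
    proof (induction n)
      case (Suc n)
      have "lam n * (1 - lam n) * l\<^sup>2 \<le> lam n * (1 - lam n) * (R n)\<^sup>2"
        using lamnn l(2) \<open>l \<ge> 0\<close> by (intro mult_left_mono power_mono)
      then show ?case using Suc fejer[OF fix0, of n] by simp
    qed simp
    then have "(\<Sum>k<n. lam k * (1 - lam k) * l\<^sup>2) \<le> (fam_dist I (z 0) w0)\<^sup>2" for n
      using zero_le_power2[of "fam_dist I (z n) w0"] by (smt (verit))
    then have "summable (\<lambda>n. lam n * (1 - lam n) * l\<^sup>2)"
      using lamnn by (intro summableI_nonneg_bounded) auto
    then show False using lamdiv lpos by (simp add: mult.commute[of _ "l\<^sup>2"] summable_cmult_iff)
  qed
  then show R_lim: "(\<lambda>n. fam_dist I (z n) (T (z n))) \<longlonglongrightarrow> 0"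
    using l(1) unfolding R_def by simp
  show "\<exists>c. fam_dist I c (T c) = 0 \<and> (\<forall>i\<in>I. weakly_converges_to (\<lambda>n. z n i) (c i))"
    by (rule Opial_weak_convergence[OF I nonexp R_lim fix0 conv])
  show "fam_dist I (z n) w \<le> fam_dist I (z 0) w" if "fam_dist I w (T w) = 0" for w n
    using decseqD[OF dec[OF that], of 0 n] by simp
qed

section \<open>The averaged reflection operator\<close>

text \<open>For \<open>m\<close> the mean of the family, this is the isometry property of reflection
  in the diagonal: the terms in \<open>m \<bullet> m\<close> cancel.\<close>

lemma sum_norm_reflect_mean:
  fixes d :: "'i \<Rightarrow> 'a::real_inner"
  assumes "(\<Sum>i\<in>I. d i) = real (card I) *\<^sub>R m"
  shows "(\<Sum>i\<in>I. (norm (2 *\<^sub>R m - d i))\<^sup>2) = (\<Sum>i\<in>I. (norm (d i))\<^sup>2)"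
proof -
  have "(norm (2 *\<^sub>R m - d i))\<^sup>2 = 4 * (m \<bullet> m) - 4 * (m \<bullet> d i) + (norm (d i))\<^sup>2" for i
    by (simp only: power2_norm_eq_inner) (simp add: inner_simps inner_commute)
  then have "(\<Sum>i\<in>I. (norm (2 *\<^sub>R m - d i))\<^sup>2) =
      4 * real (card I) * (m \<bullet> m) - 4 * (m \<bullet> (\<Sum>i\<in>I. d i)) + (\<Sum>i\<in>I. (norm (d i))\<^sup>2)"
    by (simp add: sum.distrib sum_subtractf inner_sum_right sum_distrib_left)
  then show ?thesis by (simp add: assms)
qed

text \<open>Here \<open>a\<close> and \<open>b\<close> stand for a difference of resolvent values
  and of their arguments; firm nonexpansiveness controls the cross term of the expanded
  square.\<close>

lemma modified_reflection_contraction: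
  fixes a b :: "'a::real_inner"
  assumes "(norm a)\<^sup>2 \<le> a \<bullet> b" "\<beta> \<ge> 0"
  shows "(norm ((2 * \<beta>) *\<^sub>R a - b))\<^sup>2 \<le> (norm b)\<^sup>2 - 4 * \<beta> * (1 - \<beta>) * (norm a)\<^sup>2"
proof -
  have "(norm ((2 * \<beta>) *\<^sub>R a - b))\<^sup>2 = 4 * \<beta>\<^sup>2 * (norm a)\<^sup>2 - 4 * \<beta> * (a \<bullet> b) + (norm b)\<^sup>2"
    by (simp only: power2_norm_eq_inner) (simp add: inner_simps inner_commute power2_eq_square)
  also have "\<dots> \<le> 4 * \<beta>\<^sup>2 * (norm a)\<^sup>2 - 4 * \<beta> * (norm a)\<^sup>2 + (norm b)\<^sup>2"
    using mult_left_mono[OF assms(1), of "4 * \<beta>"] assms(2) by simp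
  finally show ?thesis by (simp add: power2_eq_square algebra_simps)
qed

section \<open>Fixed points of the averaged reflection operator and convergence to the resolvent of
  the sum\<close>

theorem theorem4p6:
  fixes A :: "nat \<Rightarrow> 'a::{real_inner, complete_space} \<Rightarrow> 'a set"
    and r :: nat and \<gamma> \<beta> :: real and lam :: "nat \<Rightarrow> real" and q :: 'a
    and x :: "nat \<Rightarrow> nat \<Rightarrow> 'a" and p :: "nat \<Rightarrow> 'a"
  assumes r: "r \<ge> 1"
    and maxmon: "\<And>i. i < r \<Longrightarrow> maximal_monotone (A i)"
    and gamma: "\<gamma> > 0"
    and lam01: "\<And>n. 0 \<le> lam n \<and> lam n \<le> 1"
    and lamdiv: "\<not> summable (\<lambda>n. lam n * (1 - lam n))"
    and beta: "0 < \<beta>" "\<beta> < 1"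
    and qran: "q \<in> ran_id_plus (scale_op (\<gamma> / (real r * (1 - \<beta>))) (sum_op A {..<r}))"
    and p_def: "\<And>n. p n = (1 / real r) *\<^sub>R (\<Sum>i<r. x i n)"
    and x_rec: "\<And>i n. i < r \<Longrightarrow> x i (Suc n) =
        (1 - lam n) *\<^sub>R x i n + lam n *\<^sub>R
          ((2 * \<beta>) *\<^sub>R resolvent (scale_op \<gamma> (perturb_op (- q) (A i))) (2 *\<^sub>R p n - x i n)
           - (2 *\<^sub>R p n - x i n))"
  shows "(\<forall>i<r. (\<lambda>n. x i (Suc n) - x i n) \<longlonglongrightarrow> 0)
    \<and> (\<exists>xs. (\<forall>i<r. weakly_converges_to (\<lambda>n. x i n) (xs i))
            \<and> q + (1 / (\<beta> * real r)) *\<^sub>R (\<Sum>i<r. xs i)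
              = resolvent (scale_op (\<gamma> / (real r * (1 - \<beta>))) (sum_op A {..<r})) q)
    \<and> (\<lambda>n. q + (1 / \<beta>) *\<^sub>R p n) \<longlonglongrightarrow>
        resolvent (scale_op (\<gamma> / (real r * (1 - \<beta>))) (sum_op A {..<r})) q"
proof -
  define I where "I = {..<r}"
  define J where "J i = resolvent (scale_op \<gamma> (perturb_op (- q) (A i)))" for i
  define mean where "mean u = (1 / real r) *\<^sub>R (\<Sum>i\<in>I. u i)" for u :: "nat \<Rightarrow> 'a"
  define U where "U u i = 2 *\<^sub>R mean u - u i" for u and i :: nat
  define T where "T u i = (2 * \<beta>) *\<^sub>R J i (U u i) - U u i" for u i
  define z where "z n i = x i n" for n i
  have I: "finite I" "card I = r" "r > 0" "0 \<in> I" using r by (auto simp: I_def)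
  have sum_mean: "(\<Sum>i\<in>I. u i) = real r *\<^sub>R mean u" for u
    using I by (simp add: mean_def)
  have mm: "maximal_monotone (scale_op \<gamma> (perturb_op (- q) (A i)))" if "i \<in> I" for i
    using that gamma by (intro maximal_monotone_scale maximal_monotone_perturb maxmon) (auto simp: I_def)
  have J_mem: "\<exists>a. a \<in> A i (J i u + q) \<and> u - J i u = \<gamma> *\<^sub>R a" if "i \<in> I" for i u
    using resolvent_maximal_monotone[OF mm[OF that], of u]
    by (auto simp: J_def scale_op_def perturb_op_def)
  have J_eqI: "J i (w + \<gamma> *\<^sub>R a) = w" if "i \<in> I" "a \<in> A i (w + q)" for i w a
    unfolding J_def using that mm[OF that(1)]
    by (intro resolvent_eqI) (auto simp: maximal_monotone_def scale_op_def perturb_op_def)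

  have contraction: "(fam_dist I (T u) (T v))\<^sup>2 \<le>
      (fam_dist I u v)\<^sup>2 - 4 * \<beta> * (1 - \<beta>) * (\<Sum>i\<in>I. (norm (J i (U u i) - J i (U v i)))\<^sup>2)" for u v
  proof -
    have "(fam_dist I (T u) (T v))\<^sup>2 = (\<Sum>i\<in>I. (norm
        ((2 * \<beta>) *\<^sub>R (J i (U u i) - J i (U v i)) - (U u i - U v i)))\<^sup>2)"
      unfolding fam_dist_power2 T_def
      by (intro sum.cong arg_cong[of _ _ "\<lambda>w. (norm w)\<^sup>2"]) (auto simp: algebra_simps)
    also have "\<dots> \<le> (\<Sum>i\<in>I. (norm (U u i - U v i))\<^sup>2
        - 4 * \<beta> * (1 - \<beta>) * (norm (J i (U u i) - J i (U v i)))\<^sup>2)"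
      using resolvent_firmly_nonexpansive[OF mm] beta
      by (intro sum_mono modified_reflection_contraction) (auto simp: J_def)
    also have "\<dots> = (\<Sum>i\<in>I. (norm (U u i - U v i))\<^sup>2)
        - 4 * \<beta> * (1 - \<beta>) * (\<Sum>i\<in>I. (norm (J i (U u i) - J i (U v i)))\<^sup>2)"
      by (simp add: sum_subtractf sum_distrib_left)
    also have "(\<Sum>i\<in>I. (norm (U u i - U v i))\<^sup>2)
        = (\<Sum>i\<in>I. (norm (2 *\<^sub>R (mean u - mean v) - (u i - v i)))\<^sup>2)"
      unfolding U_def by (intro sum.cong arg_cong[of _ _ "\<lambda>w. (norm w)\<^sup>2"]) (auto simp: algebra_simps)
    also have "\<dots> = (\<Sum>i\<in>I. (norm (u i - v i))\<^sup>2)"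
      by (intro sum_norm_reflect_mean) (simp add: sum_subtractf sum_mean I scaleR_diff_right)
    finally show ?thesis by (simp add: fam_dist_power2)
  qed
  have nonexp: "fam_dist I (T u) (T v) \<le> fam_dist I u v" for u v
  proof (rule power2_le_imp_le)
    have "0 \<le> 4 * \<beta> * (1 - \<beta>) * (\<Sum>i\<in>I. (norm (J i (U u i) - J i (U v i)))\<^sup>2)"
      using beta by (intro mult_nonneg_nonneg sum_nonneg) auto
    then show "(fam_dist I (T u) (T v))\<^sup>2 \<le> (fam_dist I u v)\<^sup>2"
      using contraction[of u v] by linarith
  qed simp

  obtain w0 where w0: "fam_dist I w0 (T w0) = 0"
  proof -
    obtain y a where a: "\<And>i. i \<in> I \<Longrightarrow> a i \<in> A i y"
      and y: "q - y = (\<gamma> / (real r * (1 - \<beta>))) *\<^sub>R (\<Sum>i\<in>I. a i)"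
      using qran unfolding ran_id_plus_def scale_op_def sum_op_def I_def by blast
    \<comment> \<open>The witness is forced: a fixed point with common resolvent value
      \<open>y - q\<close> needs \<open>U w i = (y - q) + \<gamma> *\<^sub>R a i\<close> and mean
      \<open>\<beta> *\<^sub>R (y - q)\<close>, and then
      \<open>w i = 2 *\<^sub>R mean w - U w i\<close>.\<close>
    define w where "w i = (2 * \<beta> - 1) *\<^sub>R (y - q) - \<gamma> *\<^sub>R a i" for i
    have "(\<gamma> / real r) *\<^sub>R (\<Sum>i\<in>I. a i) = (1 - \<beta>) *\<^sub>R (q - y)"
      using beta I unfolding y by simp
    then have "mean w = (2 * \<beta> - 1) *\<^sub>R (y - q) - (1 - \<beta>) *\<^sub>R (q - y)"
      using I by (simp add: mean_def w_def sum_subtractf sum_constant_scaleR scaleR_diff_right flip: scaleR_sum_right)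
    also have "\<dots> = ((2 * \<beta> - 1) + (1 - \<beta>)) *\<^sub>R (y - q)"
      by (simp only: scaleR_add_left scaleR_diff_right) simp
    finally have mean_w: "mean w = \<beta> *\<^sub>R (y - q)" by simp
    have "T w i = w i" if "i \<in> I" for i
    proof -
      have Uw: "U w i = (y - q) + \<gamma> *\<^sub>R a i"
        unfolding U_def mean_w w_def by (simp add: algebra_simps)
      then have "J i (U w i) = y - q" using J_eqI[OF that, of "a i" "y - q"] a[OF that] by simp
      then have "T w i = (2 * \<beta>) *\<^sub>R (y - q) - ((y - q) + \<gamma> *\<^sub>R a i)" by (simp add: T_def Uw)
      then show ?thesis by (simp add: w_def algebra_simps)
    qed
    then show ?thesis using that[of w] I by (simp add: fam_dist_eq_0_iff)
  qed

  have p: "p n = mean (z n)" for n by (simp add: p_def mean_def z_def I_def)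
  have rec: "z (Suc n) i = (1 - lam n) *\<^sub>R z n i + lam n *\<^sub>R T (z n) i" if "i \<in> I" for n i
    using x_rec[of i n] that unfolding T_def U_def J_def z_def[symmetric] p by (simp add: I_def)
  note KM = Krasnoselskii_Mann[OF I(1) nonexp w0 lam01 lamdiv rec]
  obtain c where c: "fam_dist I c (T c) = 0"
    and weak: "\<And>i. i \<in> I \<Longrightarrow> weakly_converges_to (\<lambda>n. z n i) (c i)"
    using KM(3) by blast
  have Tc: "T c i = c i" if "i \<in> I" for i using c that I by (simp add: fam_dist_eq_0_iff)
  define d where "d = (1 / \<beta>) *\<^sub>R mean c"
  have mean_c: "mean c = \<beta> *\<^sub>R d" using beta by (simp add: d_def)
  \<comment> \<open>The fixed-point equation makes
    \<open>(2 * \<beta>) *\<^sub>R J i (U c i)\<close> equal to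
    \<open>c i + U c i = 2 *\<^sub>R mean c\<close>, which does not depend on
    \<open>i\<close>.\<close>
  have Jc: "J i (U c i) = d" if "i \<in> I" for i
  proof -
    have "(2 * \<beta>) *\<^sub>R J i (U c i) = T c i + U c i" by (simp add: T_def)
    also have "\<dots> = (2 * \<beta>) *\<^sub>R d" using Tc[OF that] by (simp add: U_def mean_c)
    finally show ?thesis using beta by simp
  qed

  \<comment> \<open>Membership of the resolvents writes \<open>U c i - d\<close> as
    \<open>\<gamma> *\<^sub>R a i\<close> with \<open>a i\<close> in \<open>A i (d + q)\<close>.
    Reflection preserves the mean \<open>\<beta> *\<^sub>R d\<close>, so summing over
    \<open>i\<close> gives the inclusion for the scaled sum.\<close>
  have res: "resolvent (scale_op (\<gamma> / (real r * (1 - \<beta>))) (sum_op A {..<r})) q = q + d"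
  proof (rule resolvent_eqI)
    show "monotone_op (scale_op (\<gamma> / (real r * (1 - \<beta>))) (sum_op A {..<r}))"
      using maxmon gamma beta I
      by (intro monotone_op_scale monotone_op_sum) (auto simp: maximal_monotone_def)
    have "\<exists>a. a \<in> A i (d + q) \<and> U c i - d = \<gamma> *\<^sub>R a" if "i \<in> I" for i
      using J_mem[OF that, of "U c i"] Jc[OF that] by simp
    then obtain a where a: "\<And>i. i \<in> I \<Longrightarrow> a i \<in> A i (d + q)" "\<And>i. i \<in> I \<Longrightarrow> U c i - d = \<gamma> *\<^sub>R a i"
      by metis
    have "\<gamma> *\<^sub>R (\<Sum>i\<in>I. a i) = (\<Sum>i\<in>I. U c i - d)"
      using a(2) by (simp add: scaleR_sum_right)
    also have "\<dots> = real r *\<^sub>R (mean c - d)"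
      by (simp add: U_def sum_subtractf sum_mean[of c] sum_constant_scaleR I
          scaleR_2 scaleR_right_distrib scaleR_diff_right)
    also have "\<dots> = (real r * (1 - \<beta>)) *\<^sub>R (- d)"
      by (simp add: mean_c algebra_simps)
    finally have "(1 / (real r * (1 - \<beta>))) *\<^sub>R (\<gamma> *\<^sub>R (\<Sum>i\<in>I. a i)) = - d"
      using I beta by simp
    then have "q - (q + d) = (\<gamma> / (real r * (1 - \<beta>))) *\<^sub>R (\<Sum>i\<in>I. a i)" by simp
    moreover have "(\<Sum>i\<in>I. a i) \<in> sum_op A {..<r} (q + d)"
      using a(1) unfolding sum_op_def I_def by (auto simp: add.commute)
    ultimately show "q - (q + d) \<in> scale_op (\<gamma> / (real r * (1 - \<beta>))) (sum_op A {..<r}) (q + d)"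
      unfolding scale_op_def by blast
  qed

  have diff: "(\<lambda>n. T (z n) i - z n i) \<longlonglongrightarrow> 0" if "i \<in> I" for i
    using norm_le_fam_dist[OF I(1) that, of "T (z _)" "z _"]
    by (intro Lim_null_comparison[OF _ KM(1)]) (simp add: fam_dist_commute)
  have "(\<lambda>n. x i (Suc n) - x i n) \<longlonglongrightarrow> 0" if "i < r" for i
  proof (rule Lim_null_comparison)
    have i: "i \<in> I" using that by (simp add: I_def)
    have "x i (Suc n) - x i n = lam n *\<^sub>R (T (z n) i - z n i)" for n
      using rec[OF i, of n] by (simp add: z_def algebra_simps)
    then have "norm (x i (Suc n) - x i n) \<le> norm (T (z n) i - z n i)" for n
      using lam01[of n] by (simp add: mult_left_le_one_le)
    then show "\<forall>\<^sub>F n in sequentially. norm (x i (Suc n) - x i n) \<le> norm (T (z n) i - z n i)"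
      by simp
    show "(\<lambda>n. norm (T (z n) i - z n i)) \<longlonglongrightarrow> 0"
      using diff[OF i] by (rule tendsto_norm_zero)
  qed
  moreover have "\<forall>i<r. weakly_converges_to (\<lambda>n. x i n) (c i)"
    using weak by (simp add: z_def I_def)
  moreover have "q + (1 / (\<beta> * real r)) *\<^sub>R (\<Sum>i<r. c i) = q + d"
    by (simp add: d_def mean_def I_def)
  moreover have "(\<lambda>n. q + (1 / \<beta>) *\<^sub>R p n) \<longlonglongrightarrow> q + d"
  proof -
    have bound: "fam_dist I (z n) c \<le> fam_dist I (z 0) c" for n
      by (rule KM(2)[OF _ c])
    have \<beta>: "0 < 4 * \<beta> * (1 - \<beta>)" using beta by simp
    \<comment> \<open>The surplus of the contraction is at most a difference of squares. In its
      factorization the difference is at most the residual and the sum is at most twice the initial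
      distance to \<open>c\<close>.\<close>
    define K where "K = 2 * fam_dist I (z 0) c / (4 * \<beta> * (1 - \<beta>))"
    have "(norm (J 0 (U (z n) 0) - d))\<^sup>2 \<le> K * fam_dist I (z n) (T (z n))" for n
    proof -
      let ?a = "fam_dist I (z n) c" and ?b = "fam_dist I (T (z n)) (T c)"
      have "(norm (J 0 (U (z n) 0) - d))\<^sup>2 \<le> (\<Sum>i\<in>I. (norm (J i (U (z n) i) - J i (U c i)))\<^sup>2)"
        using member_le_sum[of 0 I "\<lambda>i. (norm (J i (U (z n) i) - J i (U c i)))\<^sup>2"] I Jc by simp
      then have "4 * \<beta> * (1 - \<beta>) * (norm (J 0 (U (z n) 0) - d))\<^sup>2
          \<le> 4 * \<beta> * (1 - \<beta>) * (\<Sum>i\<in>I. (norm (J i (U (z n) i) - J i (U c i)))\<^sup>2)"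
        using \<beta> by (intro mult_left_mono) auto
      also have "\<dots> \<le> ?a\<^sup>2 - ?b\<^sup>2" using contraction[of "z n" c] by linarith
      also have "\<dots> = (?a - ?b) * (?a + ?b)" by (simp add: power2_eq_square algebra_simps)
      also have "\<dots> \<le> fam_dist I (z n) (T (z n)) * (2 * fam_dist I (z 0) c)"
      proof (rule mult_mono)
        show "?a - ?b \<le> fam_dist I (z n) (T (z n))"
          using fam_dist_triangle[of I "z n" c "T (z n)"] fam_dist_triangle[of I "T (z n)" c "T c"]
            c fam_dist_commute[of I c "T c"] by linarith
        show "?a + ?b \<le> 2 * fam_dist I (z 0) c"
          using bound[of n] nonexp[of "z n" c] by linarith
      qed auto
      finally show ?thesis using \<beta> by (simp add: K_def pos_le_divide_eq mult_ac)
    qed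
    then have "(\<lambda>n. (norm (J 0 (U (z n) 0) - d))\<^sup>2) \<longlonglongrightarrow> 0"
      by (intro Lim_null_comparison[OF _ tendsto_mult_right_zero[OF KM(1), of K]]) simp
    then have "(\<lambda>n. norm (J 0 (U (z n) 0) - d)) \<longlonglongrightarrow> 0"
      using tendsto_real_sqrt[of "\<lambda>n. (norm (J 0 (U (z n) 0) - d))\<^sup>2" 0] by simp
    then have J_lim: "(\<lambda>n. J 0 (U (z n) 0)) \<longlonglongrightarrow> d"
      using tendsto_norm_zero_iff LIM_zero_iff by blast
    \<comment> \<open>Solving component 0 of the definition of \<open>T\<close> for the mean
      expresses \<open>p n\<close> through strongly convergent terms only.\<close>
    have "q + (1 / \<beta>) *\<^sub>R p n =
        q + J 0 (U (z n) 0) - (1 / (2 * \<beta>)) *\<^sub>R (T (z n) 0 - z n 0)" for n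
    proof -
      have "2 *\<^sub>R p n = (2 * \<beta>) *\<^sub>R J 0 (U (z n) 0) - (T (z n) 0 - z n 0)"
        by (simp add: T_def U_def p)
      then have "(1 / (2 * \<beta>)) *\<^sub>R (2 *\<^sub>R p n) =
          (1 / (2 * \<beta>)) *\<^sub>R ((2 * \<beta>) *\<^sub>R J 0 (U (z n) 0) - (T (z n) 0 - z n 0))"
        by (rule arg_cong)
      then show ?thesis using beta by (simp add: scaleR_diff_right)
    qed
    moreover have "(\<lambda>n. q + J 0 (U (z n) 0) - (1 / (2 * \<beta>)) *\<^sub>R (T (z n) 0 - z n 0))
        \<longlonglongrightarrow> q + d - (1 / (2 * \<beta>)) *\<^sub>R 0"
      by (intro tendsto_intros J_lim diff I)
    ultimately show ?thesis by (simp only: scaleR_zero_right diff_0_right)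
  qed
  ultimately show ?thesis unfolding res by blast
qed

end
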